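(* Let $\mathcal{H}$ be a separable real Hilbert space, let $C$ be a positive-definite covariance operator on $\mathcal{H}$ with associated reproducing kernel (Cameron–Martin) Hilbert space $\mathcal{H}_C$, whose norm is denoted $\|\cdot\|_{C^{-1}}$. Let $a\in\mathcal{H}_C$ and let $\mu=\mathcal{N}(a,C)$ be a Gaussian prior. Let $u^\dagger\in\mathcal{H}_C$, let $\mathcal{I}=(\mathcal{I}_1,\dots,\mathcal{I}_d)\in(\mathcal{H}_C^* )^d$ have linearly independent components, regarded as a bounded linear map $\mathcal{I}:\mathcal{H}_C\to\mathbb{R}^d$, and let $f=\mathcal{I}u^\dagger\in\mathbb{R}^d$. Let $\bar\mu=\mathcal{N}(\bar a,\bar C)$ be the posterior measure obtained by conditioning $\mu$ on the observations $\mathcal{I}u^\dagger=f$, that is, $$\bar a=a+C\mathcal{I}^\dagger[\mathcal{I}C\mathcal{I}^\dagger]^{-1}(f-\mathcal{I}a),\qquad \bar C=C-C\mathcal{I}^\dagger[\mathcal{I}C\mathcal{I}^\dagger]^{-1}\mathcal{I}C .$$ Then for every $\mathcal{L}\in\mathcal{H}_C^*$, $$|\mathcal{L}\bar a-\mathcal{L}u^\dagger|\le(\mathcal{L}\bar C\mathcal{L}^\dagger)^{1/2}\,\|a-u^\dagger\|_{C^{-1}} .$$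
   Context: A covariance operator on $\mathcal{H}$ is a self-adjoint, positive, trace-class operator. $\mathcal{H}_C$ is the range of $C^{1/2}$ with inner product $\langle u,v\rangle_{C^{-1}}=\langle C^{-1/2}u,C^{-1/2}v\rangle_{\mathcal{H}}$ and norm $\|u\|_{C^{-1}}=\langle u,u\rangle_{C^{-1}}^{1/2}$; $\mathcal{H}_C^*$ is the space of bounded linear functionals on $\mathcal{H}_C$. Convention for the symbol $\dagger$. For bounded linear maps $A,B$ defined on $\mathcal{H}_C$, the expression $A\,C\,B^\dagger$ denotes $A B^{*}$, where $B^{*}$ is the adjoint of $B$ with respect to the inner product of $\mathcal{H}_C$ (this agrees with the literal meaning when $A,B$ extend to bounded maps on $\mathcal{H}$ and $\dagger$ is the adjoint in $\mathcal{H}$, since $C=\iota\iota^*$ for the inclusion $\iota:\mathcal{H}_C\to\mathcal{H}$). Thus $C\mathcal{I}^\dagger=\mathcal{I}^*:\mathbb{R}^d\to\mathcal{H}_C$, $\mathcal{I}C\mathcal{I}^\dagger=\mathcal{I}\mathcal{I}^*\in\mathbb{R}^{d\times d}$ (with $\mathbb{R}^d$ carrying the Euclidean inner product), and $$\mathcal{L}\bar C\mathcal{L}^\dagger=\mathcal{L}C\mathcal{L}^\dagger-\mathcal{L}C\mathcal{I}^\dagger[\mathcal{I}C\mathcal{I}^\dagger]^{-1}\mathcal{I}C\mathcal{L}^\dagger=\mathcal{L}\mathcal{L}^*-\mathcal{L}\mathcal{I}^*[\mathcal{I}\mathcal{I}^*]^{-1}\mathcal{I}\mathcal{L}^*\in\mathbb{R}.$$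 *)

theory Defs
  imports "HOL-Probability.Probability"
begin

definition positive_operator :: "('a::real_inner \<Rightarrow> 'a) \<Rightarrow> bool" where
  "positive_operator T \<longleftrightarrow>
     bounded_linear T \<and> (\<forall>x y. inner (T x) y = inner x (T y)) \<and> (\<forall>x. 0 \<le> inner (T x) x)"

definition orthonormal_basis :: "'a::real_inner set \<Rightarrow> bool" where
  "orthonormal_basis B \<longleftrightarrow>
     pairwise orthogonal B \<and> (\<forall>e\<in>B. norm e = 1) \<and> closure (span B) = UNIV"

text \<open>A positive operator equals its absolute value, so for it trace class means that the sum of
  \<open>\<langle>C e, e\<rangle>\<close> over an orthonormal basis is finite; this does not depend on the basis.\<close>

definition covariance_operator :: "('a::real_inner \<Rightarrow> 'a) \<Rightarrow> bool" where
  "covariance_operator C \<longleftrightarrow>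
     positive_operator C \<and> (\<exists>B. orthonormal_basis B \<and> (\<lambda>e. inner (C e) e) summable_on B)"

definition positive_definite :: "('a::real_inner \<Rightarrow> 'a) \<Rightarrow> bool" where
  "positive_definite C \<longleftrightarrow> (\<forall>x. x \<noteq> 0 \<longrightarrow> 0 < inner (C x) x)"

definition op_sqrt :: "('a::real_inner \<Rightarrow> 'a) \<Rightarrow> 'a \<Rightarrow> 'a" where
  "op_sqrt C = (THE S. positive_operator S \<and> S \<circ> S = C)"

text \<open>The Cameron--Martin space of \<open>C\<close> as a subset of the ambient space. For positive definite
  \<open>C\<close> the square root is injective, so \<open>inv (op_sqrt C)\<close> is \<open>C\<^sup>-\<^sup>1\<^sup>/\<^sup>2\<close> on it.\<close>

definition cm_space :: "('a::real_inner \<Rightarrow> 'a) \<Rightarrow> 'a set" where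
  "cm_space C = range (op_sqrt C)"

definition cm_inner :: "('a::real_inner \<Rightarrow> 'a) \<Rightarrow> 'a \<Rightarrow> 'a \<Rightarrow> real" where
  "cm_inner C u v = inner (inv (op_sqrt C) u) (inv (op_sqrt C) v)"

definition cm_norm :: "('a::real_inner \<Rightarrow> 'a) \<Rightarrow> 'a \<Rightarrow> real" where
  "cm_norm C u = sqrt (cm_inner C u u)"

text \<open>Maps defined on the Cameron--Martin space are rendered as total functions whose values
  outside \<open>cm_space C\<close> are irrelevant.\<close>

definition cm_dual :: "('a::real_inner \<Rightarrow> 'a) \<Rightarrow> ('a \<Rightarrow> real) set" where
  "cm_dual C = {L.
     (\<forall>u\<in>cm_space C. \<forall>v\<in>cm_space C. L (u + v) = L u + L v) \<and>
     (\<forall>u\<in>cm_space C. \<forall>r. L (r *\<^sub>R u) = r * L u) \<and>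
     (\<exists>K. \<forall>u\<in>cm_space C. \<bar>L u\<bar> \<le> K * cm_norm C u)}"

definition cm_independent :: "('a::real_inner \<Rightarrow> 'a) \<Rightarrow> ('d::finite \<Rightarrow> 'a \<Rightarrow> real) \<Rightarrow> bool" where
  "cm_independent C F \<longleftrightarrow>
     (\<forall>c. (\<forall>u\<in>cm_space C. (\<Sum>i\<in>UNIV. c i * F i u) = 0) \<longrightarrow> (\<forall>i. c i = 0))"

text \<open>The adjoint with respect to the inner product of the Cameron--Martin space. In the notation
  \<open>A C B\<^sup>\<dagger>\<close>, the part \<open>C B\<^sup>\<dagger>\<close> stands for \<open>cm_adjoint C B\<close>.\<close>

definition cm_adjoint ::
    "('a::real_inner \<Rightarrow> 'a) \<Rightarrow> ('a \<Rightarrow> 'b::real_inner) \<Rightarrow> 'b \<Rightarrow> 'a" where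
  "cm_adjoint C B y =
     (THE v. v \<in> cm_space C \<and> (\<forall>u\<in>cm_space C. inner (B u) y = cm_inner C u v))"

definition cm_sandwich ::
    "('a::real_inner \<Rightarrow> 'a) \<Rightarrow> ('a \<Rightarrow> 'c) \<Rightarrow> ('a \<Rightarrow> 'b::real_inner) \<Rightarrow> 'b \<Rightarrow> 'c" where
  "cm_sandwich C A B = A \<circ> cm_adjoint C B"

definition gram_inv :: "('a::real_inner \<Rightarrow> 'a) \<Rightarrow> ('a \<Rightarrow> real ^ 'd) \<Rightarrow> real ^ 'd ^ 'd" where
  "gram_inv C I = matrix_inv (matrix (cm_sandwich C I I))"

definition posterior_mean ::
    "('a::real_inner \<Rightarrow> 'a) \<Rightarrow> 'a \<Rightarrow> ('a \<Rightarrow> real ^ 'd) \<Rightarrow> real ^ 'd \<Rightarrow> 'a" where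
  "posterior_mean C a I f = a + cm_adjoint C I (gram_inv C I *v (f - I a))"

text \<open>As an operator on the whole ambient space; \<open>I (C x)\<close> is meaningful because \<open>C\<close> maps
  into \<open>cm_space C\<close>.\<close>

definition posterior_cov ::
    "('a::real_inner \<Rightarrow> 'a) \<Rightarrow> ('a \<Rightarrow> real ^ 'd) \<Rightarrow> 'a \<Rightarrow> 'a" where
  "posterior_cov C I x = C x - cm_adjoint C I (gram_inv C I *v I (C x))"

text \<open>The number \<open>L D L\<^sup>\<dagger>\<close> for \<open>D = posterior_cov C I\<close>, where \<open>D\<close> is expanded and each term
  \<open>A C B\<^sup>\<dagger>\<close> is read as above. A functional has values in \<open>\<real>\<close>, hence its adjoint is
  evaluated at \<open>1\<close>.\<close>

definition posterior_variance ::
    "('a::real_inner \<Rightarrow> 'a) \<Rightarrow> ('a \<Rightarrow> real ^ 'd) \<Rightarrow> ('a \<Rightarrow> real) \<Rightarrow> real" where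
  "posterior_variance C I L =
     cm_sandwich C L L 1 - cm_sandwich C L I (gram_inv C I *v cm_sandwich C I L 1)"

text \<open>Gaussian measures through their characteristic functional, which allows degenerate
  covariances.\<close>

definition gaussian_measure ::
    "'a::{real_inner, second_countable_topology} measure \<Rightarrow> 'a \<Rightarrow> ('a \<Rightarrow> 'a) \<Rightarrow> bool" where
  "gaussian_measure M m C \<longleftrightarrow>
     prob_space M \<and> sets M = sets borel \<and>
     (\<forall>h. (CLINT x|M. iexp (inner h x)) =
          exp (\<i> * complex_of_real (inner h m) - complex_of_real (inner (C h) h / 2)))"

end

theory Submission imports Defs begin

text \<open>The isometry \<open>C\<^sup>1\<^sup>/\<^sup>2\<close> from the ambient space onto the Cameron--Martin space turns \<open>L\<close> and
  the components of \<open>I\<close> into inner products with vectors \<open>l\<close> and \<open>w\<^sub>i\<close> (Riesz). If \<open>p\<close> is the component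
  of \<open>l\<close> orthogonal to the span of the \<open>w\<^sub>i\<close>, the posterior variance is \<open>\<parallel>p\<parallel>\<^sup>2\<close> and the error of the
  posterior mean is \<open>\<langle>p, C\<^sup>-\<^sup>1\<^sup>/\<^sup>2 (a - u)\<rangle>\<close>, so the bound is the Cauchy--Schwarz inequality.\<close>

section \<open>Inequalities for positive operators\<close>

text \<open>For \<open>c > 0\<close>, evaluate at the minimizer \<open>- b / c\<close>; for
  \<open>c = 0\<close>, a nonconstant affine function takes negative values; \<open>c < 0\<close> is
  impossible for large \<open>t\<close>.\<close>

lemma quadratic_nonneg_discriminant:
  fixes a b c :: real
  assumes "\<And>t. 0 \<le> a + 2 * b * t + c * t\<^sup>2"
  shows "b\<^sup>2 \<le> a * c"
proof (cases "c = 0")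
  case True
  have "b = 0"
  proof (rule ccontr)
    assume "b \<noteq> 0"
    \<comment> \<open>At this point the affine function takes the value -1.\<close>
    then show False
      using assms[of "- (a + 1) / (2 * b)"] True by simp
  qed
  then show ?thesis using True by simp
next
  case False
  have "c > 0"
  proof (rule ccontr)
    assume "\<not> c > 0"
    with False have c: "c < 0" by simp
    \<comment> \<open>Chosen so that \<open>- c * t\<close> exceeds
      \<open>\<bar>a\<bar> + 2 * \<bar>b\<bar>\<close> and \<open>1 \<le> t\<close>; the quadratic
      term then outweighs the other two.\<close>
    define t where "t = 1 + (\<bar>a\<bar> + 2 * \<bar>b\<bar>) / (-c)"
    have t1: "1 \<le> t" using c by (simp add: t_def divide_nonneg_neg)
    have ct: "- c * t = - c + \<bar>a\<bar> + 2 * \<bar>b\<bar>" using c by (simp add: t_def field_simps)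
    have "a + 2 * b * t \<le> (\<bar>a\<bar> + 2 * \<bar>b\<bar>) * t"
    proof -
      have "\<bar>a\<bar> * 1 \<le> \<bar>a\<bar> * t" using t1 by (intro mult_left_mono) auto
      moreover have "b * t \<le> \<bar>b\<bar> * t" using t1 by (intro mult_right_mono) auto
      ultimately show ?thesis by (simp add: algebra_simps)
    qed
    also have "\<dots> < (- c * t) * t" using t1 c ct by (intro mult_strict_right_mono) auto
    finally show False using assms[of t] by (simp add: power2_eq_square)
  qed
  then show ?thesis
    using assms[of "- b / c"] by (simp add: field_simps power2_eq_square)
qed

lemma positive_operator_bounded_linear: "positive_operator T \<Longrightarrow> bounded_linear T"
  and positive_operator_symmetric: "positive_operator T \<Longrightarrow> inner (T x) y = inner x (T y)"
  and positive_operator_nonneg: "positive_operator T \<Longrightarrow> 0 \<le> inner (T x) x"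
  unfolding positive_operator_def by blast+

text \<open>The nonnegative quadratic in \<open>t\<close> is the form of \<open>T\<close> at
  \<open>x + t *\<^sub>R y\<close>; symmetry merges its two mixed terms.\<close>

lemma positive_operator_Cauchy_Schwarz:
  assumes "positive_operator T"
  shows "(inner (T x) y)\<^sup>2 \<le> inner (T x) x * inner (T y) y"
proof (rule quadratic_nonneg_discriminant)
  fix t :: real
  interpret T: bounded_linear T by (rule positive_operator_bounded_linear[OF assms])
  have "inner (T y) x = inner (T x) y"
    by (metis positive_operator_symmetric[OF assms] inner_commute)
  moreover have "0 \<le> inner (T (x + t *\<^sub>R y)) (x + t *\<^sub>R y)"
    by (rule positive_operator_nonneg[OF assms])
  ultimately show "0 \<le> inner (T x) x + 2 * inner (T x) y * t + inner (T y) y * t\<^sup>2"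
    by (simp add: T.add T.scaleR inner_add power2_eq_square algebra_simps)
qed

text \<open>Taking \<open>y = T x\<close> in Cauchy--Schwarz bounds the fourth power of
  \<open>norm (T x)\<close> by 0.\<close>

lemma positive_operator_eq_0:
  assumes "positive_operator T" and "inner (T x) x = 0"
  shows "T x = 0"
  using positive_operator_Cauchy_Schwarz[OF assms(1), of x "T x"] assms(2) by simp

text \<open>Cauchy--Schwarz with \<open>y = T x\<close> and contractivity give |Tx|^2 \<le> <Tx, x>,
  so the cross term -2<Tx, x> absorbs |Tx|^2 when |x - Tx|^2 is expanded. This makes
  \<open>A = 1 - T\<close> admissible for the iteration below.\<close>

lemma norm_id_minus_positive_operator:
  assumes T: "positive_operator T" and le: "\<And>x. norm (T x) \<le> norm x"
  shows "norm (x - T x) \<le> norm x"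
proof -
  have "inner (T x) x \<ge> 0" by (rule positive_operator_nonneg[OF T])
  have "(inner (T x) (T x))\<^sup>2 \<le> inner (T x) x * inner (T (T x)) (T x)"
    by (rule positive_operator_Cauchy_Schwarz[OF T])
  also have "\<dots> \<le> inner (T x) x * inner (T x) (T x)"
  proof (intro mult_left_mono)
    have "inner (T (T x)) (T x) \<le> norm (T (T x)) * norm (T x)"
      by (rule norm_cauchy_schwarz)
    also have "\<dots> \<le> norm (T x) * norm (T x)" by (intro mult_right_mono le) auto
    finally show "inner (T (T x)) (T x) \<le> inner (T x) (T x)"
      by (simp add: power2_norm_eq_inner power2_eq_square[symmetric])
  qed fact
  finally have "inner (T x) (T x) \<le> inner (T x) x"
    by (cases "T x = 0") (simp_all add: power2_eq_square)
  then have "inner (x - T x) (x - T x) \<le> inner x x"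
    using \<open>inner (T x) x \<ge> 0\<close> by (simp add: inner_diff inner_commute)
  then show ?thesis by (simp add: norm_eq_sqrt_inner)
qed

section \<open>The square root of a positive contraction\<close>

text \<open>The classical iteration \<open>Y \<mapsto> (A + Y\<^sup>2) / 2\<close>, whose limit is \<open>1 - (1 - A)\<^sup>1\<^sup>/\<^sup>2\<close>.\<close>

fun sqrt_iter :: "('a::real_vector \<Rightarrow> 'a) \<Rightarrow> nat \<Rightarrow> 'a \<Rightarrow> 'a" where
  "sqrt_iter A 0 x = 0"
| "sqrt_iter A (Suc n) x = (1/2) *\<^sub>R (A x + sqrt_iter A n (sqrt_iter A n x))"

text \<open>The scalar iteration for \<open>A = 1\<close>; its increments dominate those of the operator iteration,
  which therefore converges in norm whenever \<open>A\<close> is a contraction.\<close>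

fun sqrt_maj :: "nat \<Rightarrow> real" where
  "sqrt_maj 0 = 0"
| "sqrt_maj (Suc n) = (1 + (sqrt_maj n)\<^sup>2) / 2"

lemma sqrt_maj_bounds: "0 \<le> sqrt_maj n" "sqrt_maj n \<le> 1"
proof (induction n)
  case (Suc n)
  { case 1 show ?case by simp }
  { case 2 show ?case using Suc by (simp add: power_le_one) }
qed auto

text \<open>This is the recursion that the bounds on the operator increments satisfy as
  well.\<close>

lemma sqrt_maj_Suc_diff:
  "sqrt_maj (Suc (Suc n)) - sqrt_maj (Suc n) =
   (sqrt_maj (Suc n) + sqrt_maj n) * (sqrt_maj (Suc n) - sqrt_maj n) / 2"
proof -
  have "(1 + a\<^sup>2) / 2 - (1 + b\<^sup>2) / 2 = (a + b) * (a - b) / 2" for a b :: real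
    by (simp add: field_simps power2_eq_square)
  then show ?thesis by (metis sqrt_maj.simps(2))
qed

lemma sqrt_maj_mono: "sqrt_maj n \<le> sqrt_maj (Suc n)"
proof (induction n)
  case (Suc n)
  then have "0 \<le> sqrt_maj (Suc (Suc n)) - sqrt_maj (Suc n)"
    unfolding sqrt_maj_Suc_diff using sqrt_maj_bounds
    by (intro divide_nonneg_pos mult_nonneg_nonneg add_nonneg_nonneg) (auto simp del: sqrt_maj.simps)
  then show ?case by simp
qed simp

lemma Cauchy_sqrt_maj: "Cauchy sqrt_maj"
proof -
  have "convergent sqrt_maj"
  proof (rule Bseq_mono_convergent)
    show "Bseq sqrt_maj" using sqrt_maj_bounds by (intro BseqI'[of _ 1]) auto
    show "\<forall>m n. m \<le> n \<longrightarrow> sqrt_maj m \<le> sqrt_maj n"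
      using lift_Suc_mono_le[of sqrt_maj] sqrt_maj_mono by blast
  qed
  then show ?thesis by (rule convergent_Cauchy)
qed

lemma linear_sqrt_iter: "linear A \<Longrightarrow> linear (sqrt_iter A n)"
proof (induction n)
  case 0
  show ?case by (intro linearI) auto
next
  case (Suc n)
  interpret A: linear A by fact
  interpret Y: linear "sqrt_iter A n" using Suc by simp
  show ?case
    by (intro linearI) (simp_all add: A.add Y.add A.scale Y.scale algebra_simps)
qed

text \<open>The triangle inequality turns the operator recursion into the scalar one, the repeated
  iterate contributing the squared majorant.\<close>

lemma norm_sqrt_iter:
  assumes "\<And>x. norm (A x) \<le> norm x"
  shows "norm (sqrt_iter A n x) \<le> sqrt_maj n * norm x"
proof (induction n arbitrary: x)
  case (Suc n)
  have "norm (sqrt_iter A n (sqrt_iter A n x)) \<le> sqrt_maj n * norm (sqrt_iter A n x)"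
    by (rule Suc)
  also have "\<dots> \<le> sqrt_maj n * (sqrt_maj n * norm x)"
    by (intro mult_left_mono Suc sqrt_maj_bounds)
  finally have "norm (A x + sqrt_iter A n (sqrt_iter A n x)) \<le> norm x + (sqrt_maj n)\<^sup>2 * norm x"
    using norm_triangle_mono[OF assms] by (simp add: power2_eq_square mult.assoc)
  then show ?case by (simp add: distrib_right del: scaleR_add_right)
qed simp

text \<open>For consecutive iterates, Z^2 - Y^2 = Z (Z - Y) + (Z - Y) Y. Bounding each factor by its
  majorant reproduces \<open>sqrt_maj_Suc_diff\<close>.\<close>

lemma norm_sqrt_iter_Suc_diff:
  assumes lin: "linear A" and le: "\<And>x. norm (A x) \<le> norm x"
  shows "norm (sqrt_iter A (Suc n) x - sqrt_iter A n x) \<le> (sqrt_maj (Suc n) - sqrt_maj n) * norm x"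
proof (induction n arbitrary: x)
  case 0
  show ?case using le[of x] by simp
next
  case (Suc n)
  define Y Z d where "Y = sqrt_iter A n" and "Z = sqrt_iter A (Suc n)"
    and "d = sqrt_maj (Suc n) - sqrt_maj n"
  have linZ: "linear Z" unfolding Z_def by (rule linear_sqrt_iter[OF lin])
  have d: "d \<ge> 0" using sqrt_maj_mono[of n] by (simp add: d_def)
  have IH: "norm (Z x - Y x) \<le> d * norm x" for x
    using Suc by (simp add: Y_def Z_def d_def)
  have "sqrt_iter A (Suc (Suc n)) x - sqrt_iter A (Suc n) x = (1/2) *\<^sub>R (Z (Z x) - Y (Y x))"
  proof -
    have "sqrt_iter A (Suc (Suc n)) x = (1/2) *\<^sub>R (A x + Z (Z x))" by (simp only: sqrt_iter.simps Z_def)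
    moreover have "sqrt_iter A (Suc n) x = (1/2) *\<^sub>R (A x + Y (Y x))" by (simp only: sqrt_iter.simps Y_def)
    ultimately show ?thesis by (simp add: algebra_simps)
  qed
  also have "Z (Z x) - Y (Y x) = Z (Z x - Y x) + (Z (Y x) - Y (Y x))"
    by (simp add: linear_diff[OF linZ])
  finally have "norm (sqrt_iter A (Suc (Suc n)) x - sqrt_iter A (Suc n) x)
      = norm (Z (Z x - Y x) + (Z (Y x) - Y (Y x))) / 2" by simp
  also have "\<dots> \<le> (sqrt_maj (Suc n) * (d * norm x) + d * (sqrt_maj n * norm x)) / 2"
  proof (intro divide_right_mono norm_triangle_mono)
    have "norm (Z (Z x - Y x)) \<le> sqrt_maj (Suc n) * norm (Z x - Y x)"
      unfolding Z_def by (rule norm_sqrt_iter[OF le])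
    also have "\<dots> \<le> sqrt_maj (Suc n) * (d * norm x)"
      by (intro mult_left_mono IH sqrt_maj_bounds)
    finally show "norm (Z (Z x - Y x)) \<le> sqrt_maj (Suc n) * (d * norm x)" .
    have "norm (Z (Y x) - Y (Y x)) \<le> d * norm (Y x)" by (rule IH)
    also have "\<dots> \<le> d * (sqrt_maj n * norm x)"
      unfolding Y_def by (intro mult_left_mono norm_sqrt_iter[OF le] d)
    finally show "norm (Z (Y x) - Y (Y x)) \<le> d * (sqrt_maj n * norm x)" .
  qed simp
  also have "\<dots> = (sqrt_maj (Suc (Suc n)) - sqrt_maj (Suc n)) * norm x"
    unfolding sqrt_maj_Suc_diff d_def[symmetric] by (simp add: algebra_simps del: sqrt_maj.simps)
  finally show ?case .
qed

lemma norm_sqrt_iter_diff: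
  assumes lin: "linear A" and le: "\<And>x. norm (A x) \<le> norm x" and "n \<le> m"
  shows "norm (sqrt_iter A m x - sqrt_iter A n x) \<le> (sqrt_maj m - sqrt_maj n) * norm x"
  using \<open>n \<le> m\<close>
proof (induction m rule: dec_induct)
  case (step m)
  have "norm (sqrt_iter A (Suc m) x - sqrt_iter A n x) \<le>
        norm (sqrt_iter A (Suc m) x - sqrt_iter A m x) + norm (sqrt_iter A m x - sqrt_iter A n x)"
    using norm_triangle_ineq[of "sqrt_iter A (Suc m) x - sqrt_iter A m x" "sqrt_iter A m x - sqrt_iter A n x"]
    by (simp del: sqrt_iter.simps)
  also have "\<dots> \<le> (sqrt_maj (Suc m) - sqrt_maj m) * norm x + (sqrt_maj m - sqrt_maj n) * norm x"
    by (intro add_mono norm_sqrt_iter_Suc_diff[OF lin le] step.IH)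
  finally show ?case by (simp add: algebra_simps del: sqrt_maj.simps sqrt_iter.simps)
qed simp

lemma Cauchy_sqrt_iter:
  assumes lin: "linear A" and le: "\<And>x. norm (A x) \<le> norm x"
  shows "Cauchy (\<lambda>n. sqrt_iter A n x)"
proof (rule CauchyI')
  fix e :: real assume "0 < e"
  \<comment> \<open>The added 1 covers \<open>x = 0\<close> and makes the final inequality
    strict.\<close>
  then have "0 < e / (norm x + 1)" by (simp add: add_nonneg_pos)
  from CauchyD[OF Cauchy_sqrt_maj this] obtain M where
    M: "\<And>m n. m \<ge> M \<Longrightarrow> n \<ge> M \<Longrightarrow> norm (sqrt_maj m - sqrt_maj n) < e / (norm x + 1)" by blast
  show "\<exists>M. \<forall>m\<ge>M. \<forall>n>m. dist (sqrt_iter A m x) (sqrt_iter A n x) < e"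
  proof (intro exI allI impI)
    fix m n assume "M \<le> m" "m < n"
    have "dist (sqrt_iter A m x) (sqrt_iter A n x) \<le> (sqrt_maj n - sqrt_maj m) * norm x"
      using norm_sqrt_iter_diff[OF lin le, of m n x] \<open>m < n\<close> by (simp add: dist_norm norm_minus_commute)
    also have "\<dots> \<le> (e / (norm x + 1)) * norm x"
      using M[of n m] \<open>M \<le> m\<close> \<open>m < n\<close> by (intro mult_right_mono) auto
    also have "\<dots> < e" using \<open>0 < e\<close> by (simp add: divide_less_eq add_nonneg_pos)
    finally show "dist (sqrt_iter A m x) (sqrt_iter A n x) < e" .
  qed
qed

text \<open>The iterates are polynomials in \<open>A\<close>. In the limit the root inherits this
  commutation, on which its uniqueness rests.\<close>

lemma sqrt_iter_commute:
  assumes "linear R" and "\<And>x. R (A x) = A (R x)"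
  shows "R (sqrt_iter A n x) = sqrt_iter A n (R x)"
  using assms(2)
  by (induction n arbitrary: x) (simp_all add: linear_0 linear_add linear_scale assms(1))

lemma sqrt_iter_symmetric:
  assumes "\<And>x y. inner (A x) y = inner x (A y)"
  shows "inner (sqrt_iter A n x) y = inner x (sqrt_iter A n y)"
  by (induction n arbitrary: x y) (simp_all add: inner_add assms)

text \<open>With \<open>A = 1 - T\<close> and \<open>Y\<close> the limit of the iteration, the
  fixed-point equation 2 Y = A + Y^2 says that (1 - Y)^2 = T, so \<open>S = 1 - Y\<close>.\<close>

lemma positive_sqrt_contraction:
  fixes T :: "'a::{real_inner, complete_space} \<Rightarrow> 'a"
  assumes T: "positive_operator T" and le: "\<And>x. norm (T x) \<le> norm x"
  obtains S where "positive_operator S" "S \<circ> S = T"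
    "\<forall>R. bounded_linear R \<longrightarrow> R \<circ> T = T \<circ> R \<longrightarrow> R \<circ> S = S \<circ> R"
proof -
  define A where "A x = x - T x" for x
  interpret T: bounded_linear T by (rule positive_operator_bounded_linear[OF T])
  have sym: "inner (T x) y = inner x (T y)" for x y by (rule positive_operator_symmetric[OF T])
  have lin: "linear A" by (intro linearI) (simp_all add: A_def T.add T.scaleR algebra_simps)
  have leA: "norm (A x) \<le> norm x" for x
    unfolding A_def by (rule norm_id_minus_positive_operator[OF T le])
  define Y where "Y x = lim (\<lambda>n. sqrt_iter A n x)" for x
  have lim: "(\<lambda>n. sqrt_iter A n x) \<longlonglongrightarrow> Y x" for x
    unfolding Y_def
    using Cauchy_sqrt_iter[OF lin leA] by (simp add: Cauchy_convergent convergent_LIMSEQ_iff[symmetric])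
  have linY: "linear Y"
  proof (intro linearI)
    fix x y r
    have "(\<lambda>n. sqrt_iter A n (x + y)) \<longlonglongrightarrow> Y x + Y y"
      unfolding linear_add[OF linear_sqrt_iter[OF lin]] by (intro tendsto_add lim)
    then show "Y (x + y) = Y x + Y y" using lim LIMSEQ_unique by blast
    have "(\<lambda>n. sqrt_iter A n (r *\<^sub>R x)) \<longlonglongrightarrow> r *\<^sub>R Y x"
      unfolding linear_scale[OF linear_sqrt_iter[OF lin]] by (intro tendsto_scaleR lim tendsto_const)
    then show "Y (r *\<^sub>R x) = r *\<^sub>R Y x" using lim LIMSEQ_unique by blast
  qed
  have contr: "norm (sqrt_iter A n x) \<le> norm x" for n x
    using norm_sqrt_iter[OF leA, of n x] mult_right_mono[OF sqrt_maj_bounds(2)[of n], of "norm x"] by simp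
  have leY: "norm (Y x) \<le> norm x" for x
    by (rule tendsto_upperbound[OF tendsto_norm[OF lim]]) (simp_all add: contr)
  have symY: "inner (Y x) y = inner x (Y y)" for x y
  proof (rule LIMSEQ_unique)
    show "(\<lambda>n. inner (sqrt_iter A n x) y) \<longlonglongrightarrow> inner (Y x) y"
      by (intro tendsto_inner lim tendsto_const)
    have "inner (sqrt_iter A n x) y = inner x (sqrt_iter A n y)" for n
      by (rule sqrt_iter_symmetric) (simp add: A_def inner_diff sym)
    then show "(\<lambda>n. inner (sqrt_iter A n x) y) \<longlonglongrightarrow> inner x (Y y)"
      by (auto intro!: tendsto_inner lim tendsto_const)
  qed
  have YY: "Y x = (1/2) *\<^sub>R (A x + Y (Y x))" for x
  proof (rule LIMSEQ_unique)
    show "(\<lambda>n. sqrt_iter A (Suc n) x) \<longlonglongrightarrow> Y x" using lim by (rule LIMSEQ_Suc)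
    \<comment> \<open>Operator and argument both vary with \<open>n\<close>: the uniform bound
      \<open>contr\<close> disposes of the moving part of the argument, and pointwise convergence at
      \<open>Y x\<close> gives the rest.\<close>
    have "(\<lambda>n. sqrt_iter A n (sqrt_iter A n x - Y x)) \<longlonglongrightarrow> 0"
    proof (rule Lim_null_comparison)
      show "\<forall>\<^sub>F n in sequentially.
          norm (sqrt_iter A n (sqrt_iter A n x - Y x)) \<le> norm (sqrt_iter A n x - Y x)"
        by (simp add: contr)
      show "(\<lambda>n. norm (sqrt_iter A n x - Y x)) \<longlonglongrightarrow> 0"
        using lim by (simp add: LIM_zero tendsto_norm_zero)
    qed
    then have "(\<lambda>n. sqrt_iter A n (sqrt_iter A n x - Y x) + sqrt_iter A n (Y x)) \<longlonglongrightarrow> 0 + Y (Y x)"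
      by (intro tendsto_add lim)
    then have "(\<lambda>n. sqrt_iter A n (sqrt_iter A n x)) \<longlonglongrightarrow> Y (Y x)"
      by (simp add: linear_diff[OF linear_sqrt_iter[OF lin]])
    then show "(\<lambda>n. sqrt_iter A (Suc n) x) \<longlonglongrightarrow> (1/2) *\<^sub>R (A x + Y (Y x))"
      by (simp, intro tendsto_intros)
  qed
  define S where "S x = x - Y x" for x
  show ?thesis
  proof
    have "bounded_linear S"
    proof (rule bounded_linear_intro)
      show "norm (S x) \<le> norm x * 2" for x
        using norm_triangle_ineq4[of x "Y x"] leY[of x] by (simp add: S_def)
    qed (simp_all add: S_def linear_add[OF linY] linear_scale[OF linY] algebra_simps)
    \<comment> \<open>Positivity of \<open>1 - Y\<close> follows because \<open>Y\<close> is a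
      contraction.\<close>
    moreover have "0 \<le> inner (S x) x" for x
    proof -
      have "inner (Y x) x \<le> norm (Y x) * norm x" by (rule norm_cauchy_schwarz)
      also have "\<dots> \<le> norm x * norm x" by (intro mult_right_mono leY) simp
      finally show ?thesis by (simp add: S_def inner_diff norm_eq_sqrt_inner)
    qed
    ultimately show "positive_operator S"
      by (simp add: positive_operator_def S_def inner_diff symY)
    show "S \<circ> S = T"
    proof
      fix x
      have "Y x + Y x = A x + Y (Y x)"
        using arg_cong[OF YY[of x], of "\<lambda>v. 2 *\<^sub>R v"] by (simp add: scaleR_2)
      then show "(S \<circ> S) x = T x"
        by (simp add: S_def linear_diff[OF linY] A_def algebra_simps)
    qed
    show "\<forall>R. bounded_linear R \<longrightarrow> R \<circ> T = T \<circ> R \<longrightarrow> R \<circ> S = S \<circ> R"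
    proof (intro allI impI ext)
      fix R :: "'a \<Rightarrow> 'a" and x
      assume R: "bounded_linear R" and "R \<circ> T = T \<circ> R"
      then have comm: "R (T x) = T (R x)" for x by (metis comp_apply)
      interpret R: bounded_linear R by fact
      have "(\<lambda>n. R (sqrt_iter A n x)) \<longlonglongrightarrow> R (Y x)" by (intro R.tendsto lim)
      moreover have "R (sqrt_iter A n x) = sqrt_iter A n (R x)" for n
        by (rule sqrt_iter_commute[OF R.linear_axioms]) (simp add: A_def R.diff comm)
      ultimately have "R (Y x) = Y (R x)" using lim[of "R x"] LIMSEQ_unique by auto
      then show "(R \<circ> S) x = (S \<circ> R) x" by (simp add: S_def R.diff)
    qed
  qed
qed

section \<open>Existence and uniqueness of the positive square root\<close>

lemma positive_operator_scaleR:
  assumes "positive_operator T" and "0 \<le> r"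
  shows "positive_operator (\<lambda>x. r *\<^sub>R T x)"
  unfolding positive_operator_def
proof (intro conjI allI)
  show "bounded_linear (\<lambda>x. r *\<^sub>R T x)"
    by (intro bounded_linear_const_scaleR positive_operator_bounded_linear assms)
  show "inner (r *\<^sub>R T x) y = inner x (r *\<^sub>R T y)" for x y
    by (simp add: positive_operator_symmetric[OF assms(1)])
  show "0 \<le> inner (r *\<^sub>R T x) x" for x
    using assms(2) positive_operator_nonneg[OF assms(1), of x] by simp
qed

text \<open>Dividing by a bound \<open>K\<close> of \<open>T\<close> gives a contraction with the
  same commutant; its root is scaled back by \<open>sqrt K\<close>.\<close>

lemma positive_sqrt:
  fixes T :: "'a::{real_inner, complete_space} \<Rightarrow> 'a"
  assumes T: "positive_operator T"
  obtains S where "positive_operator S" "S \<circ> S = T"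
    "\<forall>R. bounded_linear R \<longrightarrow> R \<circ> T = T \<circ> R \<longrightarrow> R \<circ> S = S \<circ> R"
proof -
  interpret T: bounded_linear T by (rule positive_operator_bounded_linear[OF T])
  obtain K where K: "0 < K" "\<And>x. norm (T x) \<le> norm x * K" using T.pos_bounded by blast
  have "positive_operator (\<lambda>x. inverse K *\<^sub>R T x)"
    using K(1) by (intro positive_operator_scaleR T) simp
  moreover have "norm (inverse K *\<^sub>R T x) \<le> norm x" for x
    using K by (simp add: field_simps)
  ultimately obtain S where S: "positive_operator S" "S \<circ> S = (\<lambda>x. inverse K *\<^sub>R T x)"
    and comm: "\<forall>R. bounded_linear R \<longrightarrow> R \<circ> (\<lambda>x. inverse K *\<^sub>R T x) = (\<lambda>x. inverse K *\<^sub>R T x) \<circ> R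
      \<longrightarrow> R \<circ> S = S \<circ> R"
    by (rule positive_sqrt_contraction)
  interpret S: bounded_linear S by (rule positive_operator_bounded_linear[OF S(1)])
  show ?thesis
  proof
    show "positive_operator (\<lambda>x. sqrt K *\<^sub>R S x)"
      using K(1) by (intro positive_operator_scaleR S(1)) simp
    have SS: "S (S x) = inverse K *\<^sub>R T x" for x using fun_cong[OF S(2), of x] by simp
    show "(\<lambda>x. sqrt K *\<^sub>R S x) \<circ> (\<lambda>x. sqrt K *\<^sub>R S x) = T"
      using K(1) by (simp add: fun_eq_iff S.scaleR SS flip: mult.assoc)
    show "\<forall>R. bounded_linear R \<longrightarrow> R \<circ> T = T \<circ> R \<longrightarrow>
      R \<circ> (\<lambda>x. sqrt K *\<^sub>R S x) = (\<lambda>x. sqrt K *\<^sub>R S x) \<circ> R"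
    proof (intro allI impI ext)
      fix R :: "'a \<Rightarrow> 'a" and x
      assume R: "bounded_linear R" "R \<circ> T = T \<circ> R"
      then have "R \<circ> (\<lambda>x. inverse K *\<^sub>R T x) = (\<lambda>x. inverse K *\<^sub>R T x) \<circ> R"
        by (simp add: fun_eq_iff linear_simps)
      then have "R (S x) = S (R x)" using comm R(1) by (metis comp_apply)
      then show "(R \<circ> (\<lambda>x. sqrt K *\<^sub>R S x)) x = ((\<lambda>x. sqrt K *\<^sub>R S x) \<circ> R) x"
        using R(1) by (simp add: linear_simps)
    qed
  qed
qed

text \<open>For y = (S - R) x, commutation gives (S + R) y = S^2 x - R^2 x = 0. Both nonnegative
  forms then vanish at y, so S y = R y = 0 and |y|^2 = <x, (S - R) y> = 0.\<close>

lemma positive_sqrt_unique: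
  assumes S: "positive_operator S" and R: "positive_operator R"
    and eq: "\<And>x. S (S x) = R (R x)" and comm: "\<And>x. R (S x) = S (R x)"
  shows "S = R"
proof
  fix x
  interpret S: bounded_linear S by (rule positive_operator_bounded_linear[OF S])
  interpret R: bounded_linear R by (rule positive_operator_bounded_linear[OF R])
  define y where "y = S x - R x"
  have "S y + R y = 0" by (simp add: y_def S.diff R.diff eq comm)
  then have "inner (S y) y + inner (R y) y = 0" by (simp flip: inner_add_left)
  moreover have "inner (S y) y \<ge> 0" "inner (R y) y \<ge> 0"
    by (rule positive_operator_nonneg[OF S], rule positive_operator_nonneg[OF R])
  ultimately have "S y = 0" "R y = 0"
    by (auto intro: positive_operator_eq_0 S R)
  moreover have "inner y y = inner x (S y - R y)"
    by (subst (1) y_def)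
      (simp add: inner_diff positive_operator_symmetric[OF S] positive_operator_symmetric[OF R])
  ultimately show "S x = R x" by (simp add: y_def)
qed

text \<open>A competing root \<open>R\<close> commutes with \<open>C = R \<circ> R\<close>, hence
  with the constructed root, and so equals it. This justifies the definite description in
  \<open>op_sqrt\<close>.\<close>

lemma op_sqrt:
  fixes C :: "'a::{real_inner, complete_space} \<Rightarrow> 'a"
  assumes "positive_operator C"
  shows "positive_operator (op_sqrt C)" "op_sqrt C (op_sqrt C x) = C x"
proof -
  obtain S where S: "positive_operator S" "S \<circ> S = C"
    and comm: "\<forall>R. bounded_linear R \<longrightarrow> R \<circ> C = C \<circ> R \<longrightarrow> R \<circ> S = S \<circ> R"
    by (rule positive_sqrt[OF assms])
  have "R = S" if "positive_operator R \<and> R \<circ> R = C" for R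
  proof (rule positive_sqrt_unique[symmetric])
    have "bounded_linear R" "R \<circ> C = C \<circ> R"
      using that by (auto simp: positive_operator_def)
    then have "R \<circ> S = S \<circ> R" using comm by blast
    then show "R (S x) = S (R x)" for x by (metis comp_apply)
    show "S (S x) = R (R x)" for x using S(2) that by (metis comp_apply)
  qed (use S that in auto)
  then have "op_sqrt C = S"
    unfolding op_sqrt_def using S by (intro the_equality) blast+
  with S(1,2) show "positive_operator (op_sqrt C)" "op_sqrt C (op_sqrt C x) = C x"
    by (simp_all flip: comp_apply[of S S])
qed

section \<open>The Riesz representation\<close>

text \<open>The representing vector minimizes \<open>\<parallel>x\<parallel>\<^sup>2 - 2 F x\<close>.\<close>

lemma Riesz_representation:
  fixes F :: "'a::{real_inner, complete_space} \<Rightarrow> real"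
  assumes "bounded_linear F"
  obtains w where "\<And>x. F x = inner x w"
proof -
  interpret F: bounded_linear F by fact
  obtain K where K: "\<And>x. norm (F x) \<le> norm x * K" using F.bounded by blast
  define J where "J x = inner x x - 2 * F x" for x
  \<comment> \<open>Complete the square: J x \<ge> (|x| - K)^2 - K^2.\<close>
  have bdd: "- K\<^sup>2 \<le> J x" for x
  proof -
    have "F x \<le> norm x * K" using K[of x] by simp
    moreover have "0 \<le> (norm x - K)\<^sup>2" by simp
    ultimately show ?thesis
      unfolding J_def power2_norm_eq_inner[symmetric] by (simp add: power2_diff)
  qed
  define m where "m = Inf (range J)"
  have m_le: "m \<le> J x" for x
    unfolding m_def using bdd by (intro cInf_lower bdd_belowI) auto
  have "\<exists>x. J x < m + inverse (real (Suc n))" for n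
  proof -
    have "Inf (range J) < m + inverse (real (Suc n))" by (simp add: m_def)
    then show ?thesis using bdd by (subst (asm) cInf_less_iff) (auto intro!: bdd_belowI)
  qed
  then obtain X where X: "\<And>n. J (X n) < m + inverse (real (Suc n))" by metis
  \<comment> \<open>The parallelogram law; the linear parts of \<open>J\<close> cancel. It makes a
    minimizing sequence Cauchy.\<close>
  have par: "inner (x - y) (x - y) = 2 * J x + 2 * J y - 4 * J ((1/2) *\<^sub>R (x + y))" for x y
    by (simp add: J_def F.scaleR F.add inner_add inner_diff inner_commute algebra_simps)
  have "Cauchy X"
  proof (rule CauchyI')
    fix e :: real assume "0 < e"
    \<comment> \<open>Two values of \<open>J\<close> within e^2/4 of \<open>m\<close> make the right
      side of \<open>par\<close> less than e^2.\<close>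
    then obtain M where M: "inverse (real (Suc M)) < e\<^sup>2 / 4"
      using reals_Archimedean[of "e\<^sup>2 / 4"] by auto
    show "\<exists>M. \<forall>n\<ge>M. \<forall>k>n. dist (X n) (X k) < e"
    proof (intro exI allI impI)
      fix n k assume "M \<le> n" "n < k"
      have "inverse (real (Suc n)) \<le> inverse (real (Suc M))"
           "inverse (real (Suc k)) \<le> inverse (real (Suc M))"
        using \<open>M \<le> n\<close> \<open>n < k\<close> by (auto intro!: le_imp_inverse_le)
      with X[of n] X[of k] M have "J (X n) < m + e\<^sup>2 / 4" "J (X k) < m + e\<^sup>2 / 4" by linarith+
      with par[of "X n" "X k"] m_le[of "(1/2) *\<^sub>R (X n + X k)"]
      have "(norm (X n - X k))\<^sup>2 < e\<^sup>2" unfolding power2_norm_eq_inner by linarith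
      then show "dist (X n) (X k) < e"
        using \<open>0 < e\<close> by (simp add: dist_norm power2_less_imp_less)
    qed
  qed
  then obtain w where w: "X \<longlonglongrightarrow> w" using Cauchy_convergent convergent_def by blast
  have "J w \<le> m"
  proof (rule LIMSEQ_le)
    show "(\<lambda>n. J (X n)) \<longlonglongrightarrow> J w"
      unfolding J_def by (intro tendsto_intros w F.tendsto)
    show "(\<lambda>n. m + inverse (real (Suc n))) \<longlonglongrightarrow> m"
      using tendsto_add[OF tendsto_const LIMSEQ_inverse_real_of_nat, of m] by simp
    show "\<exists>N. \<forall>n\<ge>N. J (X n) \<le> m + inverse (real (Suc n))"
      using X less_imp_le by blast
  qed
  then have min: "J w \<le> J x" for x using m_le[of x] by linarith
  \<comment> \<open>The first-order condition at the minimizer: J (w + t x) - J w is a nonnegative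
    quadratic in t with zero constant term, so its linear coefficient vanishes.\<close>
  have "(inner x w - F x)\<^sup>2 \<le> 0 * inner x x" for x
  proof (rule quadratic_nonneg_discriminant)
    fix t :: real
    show "0 \<le> 0 + 2 * (inner x w - F x) * t + inner x x * t\<^sup>2"
      using min[of "w + t *\<^sub>R x"]
      by (simp add: J_def F.add F.scaleR inner_add inner_commute power2_eq_square algebra_simps)
  qed
  then have "F x = inner x w" for x by simp
  then show ?thesis using that by blast
qed

section \<open>The Cameron--Martin space as an isometric image\<close>

locale cameron_martin =
  fixes C :: "'a::{real_inner, complete_space} \<Rightarrow> 'a"
  assumes pos: "positive_operator C" and posdef: "positive_definite C"
begin

abbreviation "S \<equiv> op_sqrt C"

sublocale S: bounded_linear S
  using op_sqrt(1)[OF pos] by (simp add: positive_operator_def)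

text \<open>The kernel of \<open>S\<close> lies in that of \<open>C\<close>, which is trivial by
  definiteness; hence \<open>inv S\<close> really inverts \<open>S\<close> on its range.\<close>

lemma inj_op_sqrt: "inj S"
proof -
  have "x = 0" if "S x = 0" for x
  proof (rule ccontr)
    assume "x \<noteq> 0"
    then have "0 < inner (C x) x" using posdef by (simp add: positive_definite_def)
    moreover have "C x = 0" using op_sqrt(2)[OF pos, of x] that by (simp add: S.zero)
    ultimately show False by simp
  qed
  then show ?thesis using S.linear_axioms by (simp add: linear_injective_0)
qed

lemma op_sqrt_in_cm_space: "S x \<in> cm_space C"
  by (simp add: cm_space_def)

lemma cm_inner_op_sqrt: "cm_inner C (S x) (S y) = inner x y"
  by (simp add: cm_inner_def inj_op_sqrt)

lemma cm_norm_op_sqrt: "cm_norm C (S x) = norm x"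
  by (simp add: cm_norm_def cm_inner_op_sqrt norm_eq_sqrt_inner)

text \<open>Pulled back along the isometry \<open>S\<close>, the functional is bounded on the
  ambient space, where Riesz applies; \<open>S w\<close> represents it in the Cameron--Martin
  space.\<close>

lemma cm_dual_representation:
  assumes "L \<in> cm_dual C"
  obtains w where "\<And>x. L (S x) = inner x w"
proof -
  from assms obtain K where K: "\<And>x. \<bar>L (S x)\<bar> \<le> K * cm_norm C (S x)"
    by (auto simp: cm_dual_def cm_space_def)
  have "bounded_linear (\<lambda>x. L (S x))"
  proof (rule bounded_linear_intro)
    show "norm (L (S x)) \<le> norm x * K" for x
      using K[of x] by (simp add: cm_norm_op_sqrt mult.commute)
  qed (use assms in \<open>auto simp: cm_dual_def cm_space_def S.add S.scaleR\<close>)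
  then show ?thesis using Riesz_representation that by blast
qed

text \<open>Adjoints can be computed after pulling back along \<open>S\<close>. Any candidate has
  the form \<open>S z\<close>, and inner products with all \<open>x\<close> determine
  \<open>z\<close>.\<close>

lemma cm_adjoint_eqI:
  assumes "\<And>x. inner (B (S x)) y = inner x w"
  shows "cm_adjoint C B y = S w"
  unfolding cm_adjoint_def
proof (rule the_equality)
  show "S w \<in> cm_space C \<and> (\<forall>u\<in>cm_space C. inner (B u) y = cm_inner C u (S w))"
    by (auto simp: cm_space_def cm_inner_op_sqrt assms)
  fix v
  assume v: "v \<in> cm_space C \<and> (\<forall>u\<in>cm_space C. inner (B u) y = cm_inner C u v)"
  then obtain z where z: "v = S z" by (auto simp: cm_space_def)
  have "inner x w = inner x z" for x
    using v[THEN conjunct2, rule_format, OF op_sqrt_in_cm_space, of x]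
    by (simp add: z cm_inner_op_sqrt assms)
  then show "v = S w" unfolding z by (metis vector_eq_rdot inner_commute)
qed

end

section \<open>The Gram matrix and the error bound\<close>

text \<open>In finite dimension a trivial kernel makes the square matrix invertible.\<close>

lemma matrix_inv_matrix:
  fixes g :: "real ^ 'd \<Rightarrow> real ^ 'd"
  assumes "linear g" and "\<And>y. g y = 0 \<Longrightarrow> y = 0"
  shows "g (matrix_inv (matrix g) *v z) = z"
proof -
  have "invertible (matrix g)"
    using assms by (simp add: invertible_left_inverse matrix_left_invertible_ker matrix_works)
  then have "matrix g *v (matrix_inv (matrix g) *v z) = z"
    by (simp add: matrix_vector_mul_assoc invertible_def matrix_inv_def someI_ex[of "\<lambda>B. matrix g ** B = mat 1 \<and> B ** matrix g = mat 1"])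
  then show ?thesis using assms(1) by (simp add: matrix_works)
qed

theorem proposition3p3:
  fixes C Cbar :: "'a::{real_inner, polish_space} \<Rightarrow> 'a"
    and a u abar :: 'a
    and \<mu> \<mu>bar :: "'a measure"
    and I :: "'a \<Rightarrow> real ^ 'd"
    and f :: "real ^ 'd"
    and L :: "'a \<Rightarrow> real"
  assumes "covariance_operator C" and "positive_definite C"
    and "a \<in> cm_space C" and "gaussian_measure \<mu> a C"
    and "u \<in> cm_space C"
    and "\<And>i. (\<lambda>v. I v $ i) \<in> cm_dual C"
    and "cm_independent C (\<lambda>i v. I v $ i)"
    and "f = I u"
    and "abar = posterior_mean C a I f"
    and "Cbar = posterior_cov C I"
    and "gaussian_measure \<mu>bar abar Cbar"
    and "L \<in> cm_dual C"
  shows "\<bar>L abar - L u\<bar> \<le> sqrt (posterior_variance C I L) * cm_norm C (a - u)"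
proof -
  interpret cameron_martin C
    using assms(1,2) by unfold_locales (simp_all add: covariance_operator_def)
  obtain \<alpha> \<beta> where a: "a = S \<alpha>" and u: "u = S \<beta>"
    using assms(3,5) by (auto simp: cm_space_def)
  obtain l where l: "\<And>x. L (S x) = inner x l"
    using cm_dual_representation[OF assms(12)] by blast
  have "\<exists>w. \<forall>x. I (S x) $ i = inner x w" for i
    using cm_dual_representation[OF assms(6)[of i]] by metis
  then obtain w where w: "\<And>i x. I (S x) $ i = inner x (w i)" by metis
  \<comment> \<open>\<open>J\<close> is \<open>I\<close> pulled back along \<open>S\<close> and
    \<open>W\<close> is its adjoint, so \<open>J (W y)\<close> is the Gram operator applied to
    \<open>y\<close>.\<close>
  define J where "J x = I (S x)" for x
  define W where "W y = (\<Sum>i\<in>UNIV. y $ i *\<^sub>R w i)" for y :: "real ^ 'd"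
  have JW: "inner (J x) y = inner x (W y)" for x y
    by (simp add: J_def W_def inner_vec_def w inner_sum_right mult.commute)
  have J_diff: "J (x - y) = J x - J y" for x y
    by (simp add: vec_eq_iff J_def w inner_diff)
  have linJW: "linear (\<lambda>y. J (W y))"
    by (intro linearI)
      (simp_all add: vec_eq_iff J_def w W_def inner_sum_left algebra_simps sum.distrib sum_distrib_left)
  have adj: "cm_adjoint C I y = S (W y)" for y
    by (rule cm_adjoint_eqI) (simp add: JW flip: J_def)
  have adjL: "cm_adjoint C L 1 = S l"
    by (rule cm_adjoint_eqI) (simp add: l)
  \<comment> \<open>J W y = 0 gives |W y|^2 = <J W y, y> = 0, so the combination of the components
    of \<open>I\<close> with coefficients \<open>y\<close> vanishes on the Cameron--Martin
    space.\<close>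
  have ker: "y = 0" if "J (W y) = 0" for y
  proof -
    have "W y = 0" using JW[of "W y" y] that by simp
    then have "(\<Sum>i\<in>UNIV. y $ i * I v $ i) = 0" if "v \<in> cm_space C" for v
      using that JW[of _ y] by (auto simp: cm_space_def J_def inner_vec_def mult.commute)
    then show ?thesis
      using assms(7) by (simp add: cm_independent_def vec_eq_iff)
  qed
  have "cm_sandwich C I I = (\<lambda>y. J (W y))"
    by (simp add: fun_eq_iff cm_sandwich_def adj J_def)
  then have inv: "J (W (gram_inv C I *v z)) = z" for z
    unfolding gram_inv_def using matrix_inv_matrix[OF linJW ker] by simp
  \<comment> \<open>\<open>e\<close> is the pulled-back prior error, \<open>W g\<close> the
    correction made by the posterior mean, and \<open>W h\<close> the orthogonal projection of
    \<open>l\<close> onto the range of \<open>W\<close>, with residual \<open>p\<close>.\<close>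
  define e where "e = \<alpha> - \<beta>"
  define g where "g = gram_inv C I *v (f - I a)"
  define h where "h = gram_inv C I *v J l"
  define p where "p = l - W h"
  \<comment> \<open>The posterior mean reproduces the data: \<open>abar - u\<close> is
    \<open>S (e + W g)\<close>, and \<open>I\<close> vanishes on it.\<close>
  have "J (e + W g) = 0"
  proof -
    have "J (W g) = - J e"
      unfolding g_def inv by (simp add: assms(8) a u e_def J_diff flip: J_def)
    \<comment> \<open>Additivity is recovered from \<open>J_diff\<close> by subtracting
      \<open>- e\<close>, itself written as \<open>0 - e\<close>.\<close>
    then show ?thesis using J_diff[of "W g" "- e"] J_diff[of 0 e] J_diff[of 0 0] by (simp add: add.commute)
  qed
  have "J p = 0" by (simp add: p_def J_diff h_def inv)
  have orth: "inner p (W y) = 0" for y using JW[of p y] \<open>J p = 0\<close> by simp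
  have "abar = S (\<alpha> + W g)"
    by (simp add: assms(9) posterior_mean_def adj a g_def S.add)
  then have "L abar - L u = inner (e + W g) l"
    by (simp add: u l e_def inner_diff_left inner_add_left)
  \<comment> \<open>\<open>W h\<close> is orthogonal to the kernel of \<open>J\<close>, so
    \<open>l\<close> may be replaced by \<open>p\<close>; then \<open>orth\<close> removes
    \<open>W g\<close>.\<close>
  also have "\<dots> = inner (e + W g) p"
    using JW[of "e + W g" h] \<open>J (e + W g) = 0\<close> by (simp add: p_def inner_diff_right)
  also have "\<dots> = inner p e"
    using orth[of g] by (simp add: inner_add_left inner_commute[of _ p] inner_add_right)
  finally have err: "L abar - L u = inner p e" .
  \<comment> \<open>Since \<open>p\<close> is orthogonal to \<open>W h\<close>, |p|^2 = <p, l>,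
    which is this difference.\<close>
  have "posterior_variance C I L = inner l l - inner (W h) l"
    by (simp add: posterior_variance_def cm_sandwich_def adj adjL l h_def J_def)
  also have "\<dots> = inner p p"
    using orth[of h] by (simp add: p_def inner_diff inner_commute)
  finally have "sqrt (posterior_variance C I L) = norm p" by (simp add: norm_eq_sqrt_inner)
  moreover have "cm_norm C (a - u) = norm e"
    unfolding a u e_def S.diff[symmetric] by (rule cm_norm_op_sqrt)
  ultimately show ?thesis using Cauchy_Schwarz_ineq2[of p e] by (simp add: err)
qed

end
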